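(* Let $X$ be a nonempty set and $Y$ a nonempty subset of $X$. Then $\operatorname{reg}(\overline{\Omega}(X,Y))=\overline{S}(X,Y)$.
   Context: $T(X)$ is the semigroup of all maps $X\to X$ under composition; maps are written on the right and composed from left to right, so $x(fg)=(xf)g$, and $Yf=\{yf\colon y\in Y\}$. Let $\overline{\Omega}(X,Y)=\{f\in T(X)\colon Yf=Y\}$, a subsemigroup of $T(X)$. If $Yf\subseteq Y$, then $f_{\upharpoonright Y}\colon Y\to Y$ denotes the map that agrees with $f$ on $Y$. Let $S(Y)$ be the symmetric group on $Y$ (all bijections $Y\to Y$), and let $\overline{S}(X,Y)=\{f\in T(X)\colon Yf\subseteq Y \text{ and } f_{\upharpoonright Y}\in S(Y)\}$, a subsemigroup of $\overline{\Omega}(X,Y)$. For a semigroup $S$, an element $a\in S$ is regular if $aba=a$ for some $b\in S$, and $\operatorname{reg}(S)$ is the set of all regular elements of $S$. *)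

theory Defs
  imports "HOL-Algebra.Bij"
begin

text \<open>
  Maps \<open>X \<rightarrow> X\<close> are represented extensionally (value \<^const>\<open>undefined\<close> outside \<open>X\<close>), so that equality
  of functions is equality of maps.  Maps are written on the right and composed from left to
  right: the product of \<open>f\<close> and \<open>g\<close> applies \<open>f\<close> first, hence the order of arguments of
  \<^const>\<open>compose\<close>.
\<close>

definition full_transf :: "'a set \<Rightarrow> ('a \<Rightarrow> 'a) monoid"
  where "full_transf X =
    \<lparr>carrier = X \<rightarrow>\<^sub>E X, mult = (\<lambda>f g. compose X g f), one = (\<lambda>x\<in>X. x)\<rparr>"

definition Omega_bar :: "'a set \<Rightarrow> 'a set \<Rightarrow> ('a \<Rightarrow> 'a) set"
  where "Omega_bar X Y = {f \<in> carrier (full_transf X). f ` Y = Y}"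

definition S_bar :: "'a set \<Rightarrow> 'a set \<Rightarrow> ('a \<Rightarrow> 'a) set"
  where "S_bar X Y = {f \<in> carrier (full_transf X). f ` Y \<subseteq> Y \<and> restrict f Y \<in> Bij Y}"

text \<open>The unit of the record plays no role in regularity.\<close>

definition reg :: "('a, 'b) monoid_scheme \<Rightarrow> 'a set"
  where "reg S = {a \<in> carrier S. \<exists>b \<in> carrier S. a \<otimes>\<^bsub>S\<^esub> b \<otimes>\<^bsub>S\<^esub> a = a}"

lemma monoid_full_transf: "monoid (full_transf X)"
  by (rule monoidI)
    (auto simp: full_transf_def compose_def PiE_iff extensional_def fun_eq_iff)

lemma submonoid_Omega_bar:
  assumes "Y \<subseteq> X"
  shows "submonoid (Omega_bar X Y) (full_transf X)"
proof
  show "Omega_bar X Y \<subseteq> carrier (full_transf X)"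
    by (auto simp: Omega_bar_def)
  show "\<one>\<^bsub>full_transf X\<^esub> \<in> Omega_bar X Y"
    using assms by (auto simp: Omega_bar_def full_transf_def image_def)
  fix f g assume f: "f \<in> Omega_bar X Y" and g: "g \<in> Omega_bar X Y"
  have "compose X g f ` Y = g ` f ` Y"
    using assms by (force simp: compose_def image_image)
  with f g show "f \<otimes>\<^bsub>full_transf X\<^esub> g \<in> Omega_bar X Y"
    by (auto simp: Omega_bar_def full_transf_def compose_def PiE_iff)
qed

lemma S_bar_subset_Omega_bar: "S_bar X Y \<subseteq> Omega_bar X Y"
  by (auto simp: S_bar_def Omega_bar_def Bij_def bij_betw_def)

end

theory Submission
  imports Defs
begin

text \<open>
  If \<open>a\<close> and \<open>b\<close> both map \<open>Y\<close> onto itself and \<open>aba = a\<close>, then cancelling the surjection \<open>a\<close> on the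
  left leaves \<open>ba = 1\<close> on \<open>Y\<close> (products compose from left to right).  So \<open>b\<close> is injective on \<open>Y\<close>, hence a permutation of \<open>Y\<close>, and its
  one-sided inverse \<open>a\<close> is a permutation too; it matters that \<open>b\<close>, and not only \<open>a\<close>, is onto \<open>Y\<close>.
  Conversely, a map \<open>a\<close> that permutes \<open>Y\<close> has a quasi-inverse which picks preimages under \<open>a\<close>:
  over a point of \<open>Y\<close> it picks the preimage that lies in \<open>Y\<close>, so that it permutes \<open>Y\<close> as well.
\<close>

lemma regular_surjection_inj_on:
  assumes a: "a ` Y = Y" and b: "b ` Y = Y" and aba: "\<And>x. x \<in> Y \<Longrightarrow> a (b (a x)) = a x"
  shows "inj_on a Y"
proof -
  have ab: "a (b y) = y" if "y \<in> Y" for y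
  proof -
    from that a obtain x where "x \<in> Y" "y = a x" by blast
    then show ?thesis by (simp add: aba)
  qed
  \<comment> \<open>Every point of \<open>Y\<close> has the form \<open>b y\<close>, so \<open>b\<close> undoes \<open>a\<close> on all of \<open>Y\<close>.\<close>
  have "b (a x) = x" if "x \<in> Y" for x
  proof -
    from that b obtain y where "y \<in> Y" "x = b y" by blast
    then show ?thesis by (simp add: ab)
  qed
  then show ?thesis by (rule inj_on_inverseI)
qed

text \<open>
  The choices of preimages over \<open>Y\<close> and off \<open>Y\<close> do not interfere, since \<open>a b a = a\<close> only asks that
  \<open>b\<close> send each point of the image of \<open>a\<close> to some preimage.  Off the image any value in \<open>X\<close> will do.
\<close>

lemma permuting_map_has_quasi_inverse:
  assumes "Y \<subseteq> X" and maps: "a \<in> X \<rightarrow> X" and bij: "bij_betw a Y Y"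
  shows "\<exists>b \<in> X \<rightarrow>\<^sub>E X. b ` Y = Y \<and> (\<forall>x\<in>X. a (b (a x)) = a x)"
proof -
  define b where "b = (\<lambda>x\<in>X. if x \<in> Y then inv_into Y a x
                             else if x \<in> a ` X then inv_into X a x else x)"
  have on_Y: "b y = inv_into Y a y" if "y \<in> Y" for y
    using that assms(1) by (auto simp: b_def)
  have inv: "bij_betw (inv_into Y a) Y Y"
    using bij by (rule bij_betw_inv_into)
  have bY: "b ` Y = Y"
  proof -
    have "b ` Y = inv_into Y a ` Y" by (rule image_cong) (simp_all add: on_Y)
    then show ?thesis using inv by (simp add: bij_betw_def)
  qed
  have bX: "b \<in> X \<rightarrow>\<^sub>E X"
  proof (rule PiE_I)
    show "b x \<in> X" if "x \<in> X" for x
      using that bY assms(1) by (cases "x \<in> Y") (auto simp: b_def inv_into_into)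
  qed (simp add: b_def)
  have aba: "a (b (a x)) = a x" if "x \<in> X" for x
  proof (cases "a x \<in> Y")
    case True
    then show ?thesis using on_Y bij by (simp add: bij_betw_inv_into_right)
  next
    case False
    then show ?thesis using that maps by (auto simp: b_def f_inv_into_f)
  qed
  show ?thesis
    by (intro bexI[OF _ bX] conjI bY ballI aba)
qed

lemma mem_S_bar_iff:
  "a \<in> S_bar X Y \<longleftrightarrow> a \<in> X \<rightarrow>\<^sub>E X \<and> bij_betw a Y Y"
proof -
  have "bij_betw (restrict a Y) Y Y = bij_betw a Y Y"
    by (rule bij_betw_cong) simp
  then show ?thesis
    by (auto simp: S_bar_def full_transf_def Bij_def dest: bij_betw_imp_surj_on)
qed

lemma mem_reg_Omega_bar_iff:
  "a \<in> reg ((full_transf X)\<lparr>carrier := Omega_bar X Y\<rparr>) \<longleftrightarrow>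
     a \<in> X \<rightarrow>\<^sub>E X \<and> a ` Y = Y \<and>
     (\<exists>b \<in> X \<rightarrow>\<^sub>E X. b ` Y = Y \<and> (\<forall>x\<in>X. a (b (a x)) = a x))"
proof -
  have "compose X a (compose X b a) = a \<longleftrightarrow> (\<forall>x\<in>X. a (b (a x)) = a x)" if "a \<in> X \<rightarrow>\<^sub>E X" for b
    using that by (auto simp: compose_def fun_eq_iff PiE_iff extensional_def)
  then show ?thesis
    by (auto simp: reg_def Omega_bar_def full_transf_def)
qed

theorem theorem3p2:
  fixes X Y :: "'a set"
  assumes "X \<noteq> {}" and "Y \<noteq> {}" and "Y \<subseteq> X"
  shows "reg ((full_transf X)\<lparr>carrier := Omega_bar X Y\<rparr>) = S_bar X Y"
proof (intro subset_antisym subsetI)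
  fix a assume "a \<in> reg ((full_transf X)\<lparr>carrier := Omega_bar X Y\<rparr>)"
  then have a: "a \<in> X \<rightarrow>\<^sub>E X" "a ` Y = Y"
    and "\<exists>b \<in> X \<rightarrow>\<^sub>E X. b ` Y = Y \<and> (\<forall>x\<in>X. a (b (a x)) = a x)"
    by (simp_all only: mem_reg_Omega_bar_iff)
  then obtain b where b: "b ` Y = Y" and aba: "\<forall>x\<in>X. a (b (a x)) = a x"
    by (elim bexE conjE)
  have "inj_on a Y"
    using a(2) b
  proof (rule regular_surjection_inj_on)
    show "a (b (a x)) = a x" if "x \<in> Y" for x
      using aba that assms(3) by (meson subsetD)
  qed
  with a show "a \<in> S_bar X Y"
    by (simp add: mem_S_bar_iff bij_betw_def)
next
  fix a assume "a \<in> S_bar X Y"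
  then have a: "a \<in> X \<rightarrow>\<^sub>E X" and bij: "bij_betw a Y Y"
    by (simp_all add: mem_S_bar_iff)
  from a have "a \<in> X \<rightarrow> X" by (simp add: PiE_iff Pi_iff)
  then have "\<exists>b \<in> X \<rightarrow>\<^sub>E X. b ` Y = Y \<and> (\<forall>x\<in>X. a (b (a x)) = a x)"
    by (rule permuting_map_has_quasi_inverse[OF assms(3) _ bij])
  moreover have "a ` Y = Y"
    using bij by (rule bij_betw_imp_surj_on)
  ultimately show "a \<in> reg ((full_transf X)\<lparr>carrier := Omega_bar X Y\<rparr>)"
    using a by (simp only: mem_reg_Omega_bar_iff simp_thms)
qed

end
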